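(* Let $\phi:[2\pi,+\infty)\to(0,\infty)$ be a continuous function with $\lim_{t\to\infty}\phi(t)=0$ such that the spiral $\mathcal{S}_\phi$ is a spiral arc, and let $s\ge 1$. Then $\mathcal{S}_\phi$ is a $\frac1s$-H\"older arc if and only if the series $\sum_{j=1}^\infty \big(H_{1/s}(\mathcal{S}_\phi^j)\big)^s$ converges.
   Context: The complex plane $\mathbb{C}$ is identified with $\mathbb{R}^2$ and carries the Euclidean metric; $\mathbf{i}$ is the imaginary unit and $\mathbb{N}=\{1,2,\dots\}$. For a continuous $\phi:[2\pi,+\infty)\to(0,\infty)$ with $\lim_{t\to\infty}\phi(t)=0$, the spiral $\mathcal{S}_\phi$ is the set $$\mathcal{S}_\phi=\{\phi(t)e^{\mathbf{i}t}: t\in[2\pi,+\infty)\}\cup\{0\}$$ with the Euclidean metric. It is a spiral arc if it has no self-intersections, i.e. $t\mapsto\phi(t)e^{\mathbf{i}t}$ is injective on $[2\pi,+\infty)$. For $j\in\mathbb{N}$ set $\mathcal{S}_\phi^j=\{\phi(t)e^{\mathbf{i}t}: t\in[2\pi j,2\pi(j+1)]\}$. A map $f:X\to Y$ between metric spaces is $\alpha$-H\"older if there is $C>0$ with $d_Y(f(x_1),f(x_2))\le C\,d_X(x_1,x_2)^\alpha$ for all $x_1,x_2\in X$ (for $\alpha=1$: Lipschitz). A metric space $X$ is an $\alpha$-H\"older arc if there is an $\alpha$-H\"older homeomorphism $f$ from $[0,1]$ onto $X$. For a metric space $(X,d_X)$ homeomorphic to $[0,1]$ and $s\ge1$, $H_{1/s}(X)\in[0,+\infty]$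 is the infimum of all constants $H>0$ for which there is a surjection $f:[0,1]\to X$ with $d_X(f(x),f(y))\le H|x-y|^{1/s}$ for all $x,y\in[0,1]$; if no such $f$ exists, $H_{1/s}(X)=\infty$. A series of terms in $[0,+\infty]$ converges if its sum is finite (in particular all terms are finite). *)

theory Defs
  imports "HOL-Analysis.Analysis"
begin

definition holder_on :: "real \<Rightarrow> 'a::metric_space set \<Rightarrow> ('a \<Rightarrow> 'b::metric_space) \<Rightarrow> bool" where
  "holder_on \<alpha> X f \<longleftrightarrow> (\<exists>C>0. \<forall>x\<in>X. \<forall>y\<in>X. dist (f x) (f y) \<le> C * dist x y powr \<alpha>)"

definition holder_arc :: "real \<Rightarrow> 'a::metric_space set \<Rightarrow> bool" where
  "holder_arc \<alpha> X \<longleftrightarrow> (\<exists>f g. homeomorphism {0..1::real} X f g \<and> holder_on \<alpha> {0..1} f)"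

(* The infimum is taken in ennreal, so it is \<infinity> if no such surjection exists. *)
definition holder_const :: "real \<Rightarrow> 'a::metric_space set \<Rightarrow> ennreal" where
  "holder_const \<alpha> X = Inf {ennreal H | H. H > 0 \<and>
     (\<exists>f. f ` {0..1::real} = X \<and>
        (\<forall>x\<in>{0..1}. \<forall>y\<in>{0..1}. dist (f x) (f y) \<le> H * \<bar>x - y\<bar> powr \<alpha>))}"

(* Real powers on [0, \<infinity>], intended for exponents s > 0, where \<infinity> to the power s is \<infinity>. *)
definition ennreal_powr :: "ennreal \<Rightarrow> real \<Rightarrow> ennreal" where
  "ennreal_powr x s = (if x = \<infinity> then \<infinity> else ennreal (enn2real x powr s))"

definition spiral_point :: "(real \<Rightarrow> real) \<Rightarrow> real \<Rightarrow> complex" where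
  "spiral_point \<phi> t = of_real (\<phi> t) * exp (\<i> * of_real t)"

definition spiral :: "(real \<Rightarrow> real) \<Rightarrow> complex set" where
  "spiral \<phi> = spiral_point \<phi> ` {2 * pi..} \<union> {0}"

definition spiral_arc :: "(real \<Rightarrow> real) \<Rightarrow> bool" where
  "spiral_arc \<phi> \<longleftrightarrow> inj_on (spiral_point \<phi>) {2 * pi..}"

definition spiral_turn :: "(real \<Rightarrow> real) \<Rightarrow> nat \<Rightarrow> complex set" where
  "spiral_turn \<phi> j = spiral_point \<phi> ` {2 * pi * real j..2 * pi * (real j + 1)}"

end

theory Submission
  imports Defs
begin

text \<open>
  If \<open>f\<close> is a \<open>1/s\<close>-Hoelder parametrization of the spiral with constant \<open>C\<close>, the preimages of the turns
  are intervals \<open>I\<^sub>j\<close> that overlap at most in endpoints, and rescaling \<open>f\<close> on \<open>I\<^sub>j\<close> shows that the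
  \<open>s\<close>-th power of the constant of the turn is at most \<open>C powr s\<close> times the length of \<open>I\<^sub>j\<close>. The
  lengths sum to at most 1 (\<open>summable_if_holder_arc\<close>).

  For the converse one has to glue surjections of the single turns, which need not be injective, to
  one homeomorphism. Instead of parametrizations the proof uses controls: functions \<open>T\<close> of the curve
  parameter with \<open>dist (\<gamma> p) (\<gamma> q) powr s \<le> T q - T p\<close> for \<open>p \<le> q\<close>. First hitting times turn a Hoelder
  surjection onto an arc into a control (\<open>control_if_holder_surjection\<close>). Conversely, an arc with
  any control, continuous or not, is a Hoelder arc: the least control is the \<open>s\<close>-variation, which is
  continuous and strictly increasing, and its inverse is the wanted change of parameter
  (\<open>holder_arc_if_control\<close>).

  Controls of the turns add up, provided chords that span several turns are under control, and here
  the geometry of the spiral enters. Since the spiral does not cross itself, each turn lies inside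
  the previous one (\<open>spiral_radius_shift_less\<close>), so everything after a given turn lies in a disc around
  the origin whose radius is at most the diameter of that turn. A chord across several turns is
  therefore bounded by what happens in just two of them (\<open>spiral_control_if_turn_controls\<close>).
\<close>

section \<open>Controls and Hoelder parametrizations of arcs\<close>

text \<open>A nondecreasing function \<open>T\<close> that absorbs the \<open>s\<close>-th powers of all chords of \<open>\<gamma>\<close>.
  Controls are the inverses of monotone \<open>1/s\<close>-Hoelder parametrizations: in the time \<open>T\<close> the curve is
  \<open>1/s\<close>-Hoelder with constant 1. The inequality is required on the half \<open>p \<le> q\<close> only, which
  makes \<open>T\<close> monotone, and continuity of \<open>T\<close> is deliberately left out, because first hitting
  times may jump.\<close>

definition control :: "real \<Rightarrow> real set \<Rightarrow> (real \<Rightarrow> 'a::metric_space) \<Rightarrow> (real \<Rightarrow> real) \<Rightarrow> bool" where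
  "control s X \<gamma> T \<longleftrightarrow>
     (\<forall>p\<in>X. \<forall>q\<in>X. p \<le> q \<longrightarrow> dist (\<gamma> p) (\<gamma> q) powr s \<le> T q - T p)"

lemma controlD:
  "control s X \<gamma> T \<Longrightarrow> p \<in> X \<Longrightarrow> q \<in> X \<Longrightarrow> p \<le> q \<Longrightarrow> dist (\<gamma> p) (\<gamma> q) powr s \<le> T q - T p"
  by (auto simp: control_def)

lemma control_mono:
  assumes "control s X \<gamma> T" "p \<in> X" "q \<in> X" "p \<le> q"
  shows "T p \<le> T q"
  using controlD[OF assms] powr_ge_zero[of "dist (\<gamma> p) (\<gamma> q)" s] by linarith

text \<open>The condition \<open>V p + d \<le> T q\<close> survives an infimum over \<open>T\<close>, first on the left and then on the
  right. Hence the pointwise infimum of all controls vanishing at \<open>a\<close> is again a control. It is the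
  \<open>s\<close>-variation of \<open>\<gamma>\<close> on \<open>[a, u]\<close>, obtained without mentioning partitions.\<close>

lemma least_control_exists:
  assumes T: "control s {a..b} \<gamma> T" and ab: "a \<le> b"
  obtains V where "control s {a..b} \<gamma> V" "V a = 0"
    "\<And>T' u. control s {a..b} \<gamma> T' \<Longrightarrow> T' a = 0 \<Longrightarrow> u \<in> {a..b} \<Longrightarrow> V u \<le> T' u"
proof -
  define C where "C = {T'. control s {a..b} \<gamma> T' \<and> T' a = 0}"
  define V where "V = (\<lambda>u. INF T'\<in>C. T' u)"
  have "(\<lambda>u. T u - T a) \<in> C"
    using T by (auto simp: C_def control_def)
  hence ne: "C \<noteq> {}" by blast
  have bdd: "bdd_below ((\<lambda>T'. T' u) ` C)" if "u \<in> {a..b}" for u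
  proof (rule bdd_belowI2[of _ 0])
    fix T' assume "T' \<in> C"
    thus "0 \<le> T' u"
      using control_mono[of s "{a..b}" \<gamma> T' a u] that ab by (auto simp: C_def)
  qed
  have least: "V u \<le> T' u" if "T' \<in> C" "u \<in> {a..b}" for T' u
    unfolding V_def using bdd[OF that(2)] that(1) by (rule cINF_lower)
  have "V a = 0"
    using ne by (auto simp: V_def C_def)
  moreover have "control s {a..b} \<gamma> V"
    unfolding control_def
  proof (intro ballI impI)
    fix p q assume pq: "p \<in> {a..b}" "q \<in> {a..b}" "p \<le> q"
    have "V p + dist (\<gamma> p) (\<gamma> q) powr s \<le> T' q" if "T' \<in> C" for T'
      using controlD[of s "{a..b}" \<gamma> T' p q] pq that least[OF that pq(1)] by (auto simp: C_def)
    hence "V p + dist (\<gamma> p) (\<gamma> q) powr s \<le> V q"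
      unfolding V_def by (intro cINF_greatest ne) (auto simp: V_def)
    thus "dist (\<gamma> p) (\<gamma> q) powr s \<le> V q - V p" by simp
  qed
  ultimately show ?thesis
    using that least by (auto simp: C_def)
qed

text \<open>A jump of \<open>V\<close> could be lowered, contradicting minimality. A jump of size \<open>e\<close> from the left at \<open>u\<close>
  leaves room to replace the single value \<open>V u\<close> by \<open>V u - e/2\<close>; a jump of size \<open>e\<close> to the right of
  \<open>u\<close> leaves room to subtract \<open>e/2\<close> on a short interval \<open>(u, u + \<delta>)\<close>. In both cases the only
  chords at risk are those whose right end \<open>q\<close> lies in the lowered set, and moving that end across
  the jump changes the \<open>s\<close>-th power of the chord by at most \<open>e/2\<close>, by uniform continuity.\<close>

lemma least_control_continuous:
  fixes \<gamma> :: "real \<Rightarrow> 'a::metric_space"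
  assumes cont: "continuous_on {a..b} \<gamma>" and s: "s > 0"
    and V: "control s {a..b} \<gamma> V" "V a = 0"
    and least: "\<And>T' u. control s {a..b} \<gamma> T' \<Longrightarrow> T' a = 0 \<Longrightarrow> u \<in> {a..b} \<Longrightarrow> V u \<le> T' u"
  shows "continuous_on {a..b} V"
proof -
  define d where "d = (\<lambda>z. dist (\<gamma> (fst z)) (\<gamma> (snd z)) powr s)"
  have mono: "V p \<le> V q" if "p \<in> {a..b}" "q \<in> {a..b}" "p \<le> q" for p q
    using control_mono[OF V(1) that] .
  have "continuous_on ({a..b} \<times> {a..b}) d"
    unfolding d_def using s
    by (intro continuous_on_powr' continuous_on_dist continuous_on_const
        continuous_on_compose2[OF cont] continuous_on_fst continuous_on_snd continuous_on_id) auto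
  hence uc: "uniformly_continuous_on ({a..b} \<times> {a..b}) d"
    by (intro compact_uniformly_continuous compact_Times) auto
  \<comment> \<open>The lowering distance must not depend on the left end of the chord, whence uniform continuity.\<close>
  have near: "\<exists>\<delta>>0. \<forall>p\<in>{a..b}. \<forall>q\<in>{a..b}. \<forall>q'\<in>{a..b}. \<bar>q - q'\<bar> < \<delta> \<longrightarrow>
      dist (\<gamma> p) (\<gamma> q) powr s \<le> dist (\<gamma> p) (\<gamma> q') powr s + e" if e: "e > 0" for e
  proof -
    obtain \<delta> where \<delta>: "\<delta> > 0"
      "\<forall>z\<in>{a..b} \<times> {a..b}. \<forall>z'\<in>{a..b} \<times> {a..b}. dist z' z < \<delta> \<longrightarrow> dist (d z') (d z) < e"
      using uc e unfolding uniformly_continuous_on_def by blast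
    show ?thesis
    proof (intro exI[of _ \<delta>] conjI ballI impI \<delta>(1))
      fix p q q' assume "p \<in> {a..b}" "q \<in> {a..b}" "q' \<in> {a..b}" "\<bar>q - q'\<bar> < \<delta>"
      hence "dist (d (p, q)) (d (p, q')) < e"
        by (intro \<delta>(2)[rule_format]) (auto simp: dist_Pair_Pair dist_real_def)
      thus "dist (\<gamma> p) (\<gamma> q) powr s \<le> dist (\<gamma> p) (\<gamma> q') powr s + e"
        by (simp add: d_def dist_real_def)
    qed
  qed
  have left: "\<exists>t\<in>{a..<u}. V u - e < V t" if u: "u \<in> {a..b}" "a < u" and e: "e > 0" for u e
  proof (rule ccontr)
    assume "\<not> ?thesis"
    hence jump: "V t \<le> V u - e" if "t \<in> {a..<u}" for t using that by force
    obtain \<delta> where \<delta>: "\<delta> > 0" "\<And>p q q'. p \<in> {a..b} \<Longrightarrow> q \<in> {a..b} \<Longrightarrow> q' \<in> {a..b} \<Longrightarrow> \<bar>q - q'\<bar> < \<delta> \<Longrightarrow>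
      dist (\<gamma> p) (\<gamma> q) powr s \<le> dist (\<gamma> p) (\<gamma> q') powr s + e / 2"
      using near[of "e/2"] e by (metis half_gt_zero)
    define V' where "V' = V(u := V u - e / 2)"
    have "control s {a..b} \<gamma> V'"
      unfolding control_def
    proof (intro ballI impI)
      fix p q assume pq: "p \<in> {a..b}" "q \<in> {a..b}" "p \<le> q"
      show "dist (\<gamma> p) (\<gamma> q) powr s \<le> V' q - V' p"
      proof (cases "p < u \<and> q = u")
        case True
        define r where "r = max p (u - \<delta> / 2)"
        have r: "p \<le> r" "r < u" "\<bar>u - r\<bar> < \<delta>" "r \<in> {a..b}"
          using True pq \<delta>(1) u by (auto simp: r_def)
        have "dist (\<gamma> p) (\<gamma> u) powr s \<le> dist (\<gamma> p) (\<gamma> r) powr s + e / 2"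
          using \<delta>(2)[of p u r] pq r u by auto
        also have "dist (\<gamma> p) (\<gamma> r) powr s \<le> V r - V p"
          using controlD[OF V(1), of p r] pq r by auto
        also have "V r \<le> V u - e" using jump r pq by auto
        finally show ?thesis using True by (simp add: V'_def)
      next
        case False
        have "dist (\<gamma> p) (\<gamma> q) powr s \<le> V q - V p" using controlD[OF V(1)] pq by auto
        thus ?thesis using False pq e by (auto simp: V'_def)
      qed
    qed
    hence "V u \<le> V' u" using least[of V' u] u V(2) by (auto simp: V'_def)
    thus False using e by (simp add: V'_def)
  qed
  have right: "\<exists>t\<in>{u<..b}. V t < V u + e" if u: "u \<in> {a..b}" "u < b" and e: "e > 0" for u e
  proof (rule ccontr)
    assume "\<not> ?thesis"
    hence jump: "V u + e \<le> V t" if "t \<in> {u<..b}" for t using that by force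
    obtain \<delta> where \<delta>: "\<delta> > 0" "\<And>p q q'. p \<in> {a..b} \<Longrightarrow> q \<in> {a..b} \<Longrightarrow> q' \<in> {a..b} \<Longrightarrow> \<bar>q - q'\<bar> < \<delta> \<Longrightarrow>
      dist (\<gamma> p) (\<gamma> q) powr s \<le> dist (\<gamma> p) (\<gamma> q') powr s + e / 2"
      using near[of "e/2"] e by (metis half_gt_zero)
    define V' where "V' = (\<lambda>t. if t \<in> {u<..<u + \<delta>} then V t - e / 2 else V t)"
    have "control s {a..b} \<gamma> V'"
      unfolding control_def
    proof (intro ballI impI)
      fix p q assume pq: "p \<in> {a..b}" "q \<in> {a..b}" "p \<le> q"
      show "dist (\<gamma> p) (\<gamma> q) powr s \<le> V' q - V' p"
      proof (cases "p \<le> u \<and> q \<in> {u<..<u + \<delta>}")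
        case True
        have "dist (\<gamma> p) (\<gamma> q) powr s \<le> dist (\<gamma> p) (\<gamma> u) powr s + e / 2"
          using \<delta>(2)[of p q u] pq True u by auto
        also have "dist (\<gamma> p) (\<gamma> u) powr s \<le> V u - V p"
          using controlD[OF V(1), of p u] pq True u by auto
        also have "V u \<le> V q - e" using jump[of q] True pq by auto
        finally show ?thesis using True by (simp add: V'_def)
      next
        case False
        have "dist (\<gamma> p) (\<gamma> q) powr s \<le> V q - V p" using controlD[OF V(1)] pq by auto
        thus ?thesis using False pq e by (auto simp: V'_def)
      qed
    qed
    moreover have "V' a = 0" using u V(2) by (auto simp: V'_def)
    moreover define t where "t = min b (u + \<delta> / 2)"
    ultimately have "V t \<le> V' t" using least[of V' t] u \<delta>(1) by auto
    moreover have "t \<in> {u<..<u + \<delta>}" using u \<delta>(1) by (auto simp: t_def)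
    ultimately show False using e by (simp add: V'_def)
  qed
  show ?thesis
    unfolding continuous_on_iff
  proof (intro ballI allI impI)
    fix u e :: real assume u: "u \<in> {a..b}" and e: "0 < e"
    obtain l where l: "l < u" "\<And>t. t \<in> {a..b} \<Longrightarrow> l < t \<Longrightarrow> V u - e < V t"
    proof (cases "a < u")
      case True
      then obtain l where "l \<in> {a..<u}" "V u - e < V l" using left[OF u True e] by blast
      thus ?thesis using that[of l] mono[of l] u by force
    next
      case False
      hence "V u - e < V t" if "t \<in> {a..b}" for t
        using that mono[of u t] e u by force
      thus ?thesis using that[of "u - 1"] by auto
    qed
    obtain r where r: "u < r" "\<And>t. t \<in> {a..b} \<Longrightarrow> t < r \<Longrightarrow> V t < V u + e"
    proof (cases "u < b")
      case True
      then obtain r where "r \<in> {u<..b}" "V r < V u + e" using right[OF u True e] by blast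
      thus ?thesis using that[of r] mono[of _ r] u by force
    next
      case False
      hence "V t < V u + e" if "t \<in> {a..b}" for t
        using that mono[of t u] e u by force
      thus ?thesis using that[of "u + 1"] by auto
    qed
    show "\<exists>d>0. \<forall>x'\<in>{a..b}. dist x' u < d \<longrightarrow> dist (V x') (V u) < e"
    proof (intro exI[of _ "min (u - l) (r - u)"] conjI ballI impI)
      fix t assume t: "t \<in> {a..b}" "dist t u < min (u - l) (r - u)"
      hence "l < t" "t < r" by (auto simp: dist_real_def)
      thus "dist (V t) (V u) < e" using l(2)[OF t(1)] r(2)[OF t(1)] by (auto simp: dist_real_def)
    qed (use l r in auto)
  qed
qed

text \<open>The least control is continuous, and it is strictly increasing because \<open>\<gamma>\<close> is injective. So it may
  serve as a time: \<open>\<gamma> \<circ> V\<inverse>\<close> is a homeomorphism, and the control inequality says that it is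
  \<open>1/s\<close>-Hoelder. A control with jumps would not do: there the reparametrized curve rests and
  is not injective.\<close>

lemma holder_arc_if_control:
  fixes \<gamma> :: "real \<Rightarrow> 'a::metric_space"
  assumes cont: "continuous_on {a..b} \<gamma>" and inj: "inj_on \<gamma> {a..b}" and ab: "a < b" and s: "s > 0"
    and T: "control s {a..b} \<gamma> T"
  shows "holder_arc (1 / s) (\<gamma> ` {a..b})"
proof -
  obtain V where V: "control s {a..b} \<gamma> V" "V a = 0"
    "\<And>T' u. control s {a..b} \<gamma> T' \<Longrightarrow> T' a = 0 \<Longrightarrow> u \<in> {a..b} \<Longrightarrow> V u \<le> T' u"
    using least_control_exists[OF T] ab by (metis less_imp_le)
  have Vcont: "continuous_on {a..b} V"
    by (rule least_control_continuous[OF cont s V(1,2)]) (rule V(3))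
  have strict: "V p < V q" if "p \<in> {a..b}" "q \<in> {a..b}" "p < q" for p q
  proof -
    have "0 < dist (\<gamma> p) (\<gamma> q) powr s"
      using inj_onD[OF inj, of p q] that by auto
    also have "\<dots> \<le> V q - V p" using controlD[OF V(1), of p q] that by auto
    finally show ?thesis by simp
  qed
  \<comment> \<open>\<open>V a = 0\<close>, so dividing by the total length \<open>V b\<close> normalizes the time interval to \<open>[0, 1]\<close>.\<close>
  define L where "L = V b"
  have L: "L > 0" using strict[of a b] ab V(2) by (auto simp: L_def)
  define W where "W = (\<lambda>u. V u / L)"
  have Wcont: "continuous_on {a..b} W"
    unfolding W_def using L by (intro continuous_intros Vcont) auto
  have Winj: "inj_on W {a..b}"
    unfolding W_def using strict L by (intro linorder_inj_onI) (auto, force)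
  have Wim: "W ` {a..b} = {0..1}"
  proof
    show "W ` {a..b} \<subseteq> {0..1}"
      using control_mono[OF V(1), of a] control_mono[OF V(1), of _ b] V(2) L
      by (auto simp: W_def L_def)
    show "{0..1} \<subseteq> W ` {a..b}"
    proof
      fix y :: real assume "y \<in> {0..1}"
      hence "\<exists>x\<ge>a. x \<le> b \<and> W x = y"
        using IVT'[of W a y b] Wcont ab L V(2) by (auto simp: W_def L_def)
      thus "y \<in> W ` {a..b}" by force
    qed
  qed
  obtain W' where W': "homeomorphism {a..b} {0..1} W W'"
    using homeomorphism_compact[OF _ Wcont Wim Winj] by auto
  obtain \<gamma>' where \<gamma>': "homeomorphism {a..b} (\<gamma> ` {a..b}) \<gamma> \<gamma>'"
    using homeomorphism_compact[OF _ cont refl inj] by auto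
  have "homeomorphism {0..1} (\<gamma> ` {a..b}) (\<gamma> \<circ> W') (W \<circ> \<gamma>')"
    using homeomorphism_compose[OF homeomorphism_symD[OF W'] \<gamma>'] .
  moreover have "holder_on (1 / s) {0..1} (\<gamma> \<circ> W')"
    unfolding holder_on_def
  proof (intro exI[of _ "L powr (1 / s)"] conjI ballI)
    fix x y :: real assume xy: "x \<in> {0..1}" "y \<in> {0..1}"
    have mem: "W' x \<in> {a..b}" "W' y \<in> {a..b}"
      using homeomorphism_image2[OF W'] xy by auto
    have "W (W' x) = x" "W (W' y) = y"
      using homeomorphism_apply2[OF W'] xy by auto
    hence val: "V (W' x) = L * x" "V (W' y) = L * y" using L by (auto simp: W_def field_simps)
    have "dist (\<gamma> (W' x)) (\<gamma> (W' y)) powr s \<le> \<bar>V (W' x) - V (W' y)\<bar>"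
      using controlD[OF V(1), of "W' x" "W' y"] controlD[OF V(1), of "W' y" "W' x"] mem
      by (cases "W' x \<le> W' y") (auto simp: dist_commute)
    also have "\<dots> = L * dist x y"
      using L by (simp add: val dist_real_def abs_mult flip: right_diff_distrib)
    finally have "(dist (\<gamma> (W' x)) (\<gamma> (W' y)) powr s) powr (1 / s) \<le> (L * dist x y) powr (1 / s)"
      using s by (intro powr_mono2) auto
    thus "dist ((\<gamma> \<circ> W') x) ((\<gamma> \<circ> W') y) \<le> L powr (1 / s) * dist x y powr (1 / s)"
      using s L by (simp add: powr_powr powr_mult)
  qed (use L in auto)
  ultimately show ?thesis unfolding holder_arc_def by blast
qed

text \<open>A Hoelder surjection \<open>f\<close> onto an arc may run back and forth, but its first hitting times are
  ordered. Reading \<open>f\<close> in the coordinate of the arc gives a real function \<open>g = \<gamma>\<inverse> \<circ> f\<close>; after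
  a possible time reversal, \<open>g\<close> goes from \<open>a\<close> to \<open>b\<close>, and by the intermediate value theorem it
  passes \<open>u\<close> before it first reaches \<open>v > u\<close>. The Hoelder inequality at two first hitting
  times, raised to the power \<open>s\<close>, is a control inequality.\<close>

lemma control_if_holder_surjection:
  fixes \<gamma> :: "real \<Rightarrow> 'a::metric_space"
  assumes cont: "continuous_on {a..b} \<gamma>" and inj: "inj_on \<gamma> {a..b}" and ab: "a \<le> b" and s: "s > 0"
    and H: "H > 0" and surj: "f ` {0..1::real} = \<gamma> ` {a..b}"
    and holder: "\<And>x y. x \<in> {0..1} \<Longrightarrow> y \<in> {0..1} \<Longrightarrow> dist (f x) (f y) \<le> H * \<bar>x - y\<bar> powr (1 / s)"
  obtains T where "control s {a..b} \<gamma> T" "T a = 0" "T b \<le> H powr s"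
proof -
  obtain \<gamma>' where \<gamma>': "homeomorphism {a..b} (\<gamma> ` {a..b}) \<gamma> \<gamma>'"
    using homeomorphism_compact[OF _ cont refl inj] by auto
  \<comment> \<open>\<open>F\<close> is \<open>f\<close> or its time reversal, whichever visits \<open>\<gamma> a\<close> before \<open>\<gamma> b\<close>.\<close>
  obtain F x0 x1 where F: "F ` {0..1::real} = \<gamma> ` {a..b}"
      "\<And>x y. x \<in> {0..1} \<Longrightarrow> y \<in> {0..1} \<Longrightarrow> dist (F x) (F y) \<le> H * \<bar>x - y\<bar> powr (1 / s)"
    and x01: "0 \<le> x0" "x0 \<le> x1" "x1 \<le> 1" "F x0 = \<gamma> a" "F x1 = \<gamma> b"
  proof -
    obtain y0 y1 where y: "y0 \<in> {0..1}" "y1 \<in> {0..1}" "f y0 = \<gamma> a" "f y1 = \<gamma> b"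
    proof -
      have "\<gamma> a \<in> f ` {0..1}" "\<gamma> b \<in> f ` {0..1}" using surj ab by auto
      thus ?thesis using that by (metis imageE)
    qed
    show ?thesis
    proof (cases "y0 \<le> y1")
      case True
      thus ?thesis using that[of f y0 y1] surj holder y by auto
    next
      case False
      have "(\<lambda>x. f (1 - x)) ` {0..1} = f ` (\<lambda>x. 1 - x) ` {0..1}" by (simp only: image_image)
      also have "(\<lambda>x. 1 - x) ` {0..1::real} = {0..1}" by simp
      finally have *: "(\<lambda>x. f (1 - x)) ` {0..1} = \<gamma> ` {a..b}" using surj by simp
      show ?thesis
      proof (rule that[of "\<lambda>x. f (1 - x)" "1 - y0" "1 - y1", OF *])
        fix x y :: real assume "x \<in> {0..1}" "y \<in> {0..1}"
        thus "dist (f (1 - x)) (f (1 - y)) \<le> H * \<bar>x - y\<bar> powr (1 / s)"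
          using holder[of "1 - x" "1 - y"] by (simp add: abs_minus_commute)
      qed (use y False in auto)
    qed
  qed
  have Fcont: "continuous_on {0..1} F"
    unfolding continuous_on_def
  proof
    fix x :: real assume x: "x \<in> {0..1}"
    have "((\<lambda>y. H * \<bar>y - x\<bar> powr (1 / s)) \<longlongrightarrow> H * \<bar>x - x\<bar> powr (1 / s)) (at x within {0..1})"
      using s by (intro tendsto_intros tendsto_powr') auto
    hence lim: "((\<lambda>y. H * \<bar>y - x\<bar> powr (1 / s)) \<longlongrightarrow> 0) (at x within {0..1})" by simp
    show "(F \<longlongrightarrow> F x) (at x within {0..1})"
    proof (rule tendsto_dist_iff[THEN iffD2], rule tendsto_sandwich[OF _ _ tendsto_const lim])
      show "\<forall>\<^sub>F y in at x within {0..1}. dist (F y) (F x) \<le> H * \<bar>y - x\<bar> powr (1 / s)"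
        unfolding eventually_at_filter
        by (intro always_eventually allI impI F(2) x)
    qed simp
  qed
  define g where "g = \<gamma>' \<circ> F"
  have gcont: "continuous_on {0..1} g"
    unfolding g_def using Fcont homeomorphism_cont2[OF \<gamma>'] F(1)
    by (intro continuous_on_compose) auto
  have \<gamma>g: "\<gamma> (g x) = F x" if "x \<in> {0..1}" for x
  proof -
    have "F x \<in> \<gamma> ` {a..b}" using F(1) that by blast
    thus ?thesis using homeomorphism_apply2[OF \<gamma>'] by (simp add: g_def)
  qed
  have gx: "g x0 = a" "g x1 = b"
    using homeomorphism_apply1[OF \<gamma>'] x01 ab by (auto simp: g_def)
  \<comment> \<open>Only times after \<open>x0\<close> count, so that the path starts at \<open>\<gamma> a\<close> as the intermediate value theorem needs.\<close>
  define S where "S = (\<lambda>u. {x \<in> {x0..1}. g x = u})"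
  define \<tau> where "\<tau> = (\<lambda>u. Inf (S u))"
  have \<tau>S: "\<tau> u \<in> S u" if u: "u \<in> {a..b}" for u
  proof -
    have "\<exists>x\<ge>x0. x \<le> x1 \<and> g x = u"
      using u x01 by (intro IVT') (auto simp: gx intro: continuous_on_subset[OF gcont])
    hence "S u \<noteq> {}" using x01 by (auto simp: S_def intro: order_trans)
    moreover have "closed (S u)"
      unfolding S_def
      by (intro continuous_closed_preimage_constant continuous_on_subset[OF gcont]) (use x01 in auto)
    moreover have "bdd_below (S u)" by (auto simp: S_def intro: bdd_belowI[of _ x0])
    ultimately show ?thesis unfolding \<tau>_def by (intro closed_contains_Inf)
  qed
  have \<tau>le: "\<tau> u \<le> x" if "x \<in> S u" for u x
    unfolding \<tau>_def using that by (intro cInf_lower bdd_belowI[of _ x0]) (auto simp: S_def)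
  have \<tau>mono: "\<tau> u \<le> \<tau> v" if uv: "u \<in> {a..b}" "v \<in> {a..b}" "u \<le> v" for u v
  proof -
    have v: "x0 \<le> \<tau> v" "\<tau> v \<le> 1" "g (\<tau> v) = v" using \<tau>S[OF uv(2)] by (auto simp: S_def)
    have "\<exists>x\<ge>x0. x \<le> \<tau> v \<and> g x = u"
      using uv v x01 by (intro IVT') (auto simp: gx intro: continuous_on_subset[OF gcont])
    then obtain x where "x0 \<le> x" "x \<le> \<tau> v" "g x = u" by blast
    thus ?thesis using \<tau>le[of x u] v by (auto simp: S_def)
  qed
  have \<tau>a: "\<tau> a = x0"
    using \<tau>le[of x0 a] \<tau>S[of a] x01 gx ab by (force simp: S_def)
  show ?thesis
  proof (rule that[of "\<lambda>u. H powr s * (\<tau> u - \<tau> a)"])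
    show "control s {a..b} \<gamma> (\<lambda>u. H powr s * (\<tau> u - \<tau> a))"
      unfolding control_def
    proof (intro ballI impI)
      fix p q assume pq: "p \<in> {a..b}" "q \<in> {a..b}" "p \<le> q"
      have mem: "\<tau> p \<in> {0..1}" "\<tau> q \<in> {0..1}" "g (\<tau> p) = p" "g (\<tau> q) = q"
        using \<tau>S[OF pq(1)] \<tau>S[OF pq(2)] x01 by (auto simp: S_def)
      have "dist (\<gamma> p) (\<gamma> q) = dist (F (\<tau> p)) (F (\<tau> q))"
        using \<gamma>g[OF mem(1)] \<gamma>g[OF mem(2)] mem by simp
      also have "\<dots> \<le> H * (\<tau> q - \<tau> p) powr (1 / s)"
        using F(2)[OF mem(1,2)] \<tau>mono[OF pq] by simp
      finally have "dist (\<gamma> p) (\<gamma> q) powr s \<le> (H * (\<tau> q - \<tau> p) powr (1 / s)) powr s"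
        using s by (intro powr_mono2) auto
      also have "\<dots> = H powr s * (\<tau> q - \<tau> p)"
        using H s \<tau>mono[OF pq] by (simp add: powr_mult powr_powr)
      finally show "dist (\<gamma> p) (\<gamma> q) powr s \<le> H powr s * (\<tau> q - \<tau> a) - H powr s * (\<tau> p - \<tau> a)"
        by (simp add: algebra_simps)
    qed
    have "\<tau> b \<le> 1" using \<tau>S[of b] ab by (auto simp: S_def)
    hence "\<tau> b - \<tau> a \<le> 1" using \<tau>a x01 by simp
    thus "H powr s * (\<tau> b - \<tau> a) \<le> H powr s"
      by (intro mult_left_le) auto
  qed simp
qed

section \<open>The geometry of a spiral arc\<close>

lemma spiral_point_eq_cis: "spiral_point \<phi> t = of_real (\<phi> t) * cis t"
  by (simp add: spiral_point_def cis_conv_exp)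

lemma norm_spiral_point: "\<phi> t \<ge> 0 \<Longrightarrow> norm (spiral_point \<phi> t) = \<phi> t"
  by (simp add: spiral_point_eq_cis norm_mult)

text \<open>Indexed from 0 so that \<open>turn_start j\<close> begins the turn with number \<open>Suc j\<close>, in step with the series
  over all \<open>j\<close>, whose first term belongs to turn 1.\<close>

definition turn_start :: "nat \<Rightarrow> real" where
  "turn_start j = 2 * pi * real (Suc j)"

lemma turn_start_0: "turn_start 0 = 2 * pi"
  by (simp add: turn_start_def)

lemma turn_start_Suc: "turn_start (Suc j) = turn_start j + 2 * pi"
  by (simp add: turn_start_def algebra_simps)

lemma turn_start_add: "turn_start (j + n) = turn_start j + 2 * pi * real n"
  by (simp add: turn_start_def algebra_simps)

lemma turn_start_mono: "i \<le> j \<Longrightarrow> turn_start i \<le> turn_start j"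
  by (simp add: turn_start_def)

lemma turn_start_less_Suc: "turn_start j < turn_start (Suc j)"
  by (simp add: turn_start_Suc)

lemma turn_start_ge: "2 * pi \<le> turn_start j"
  using turn_start_mono[of 0 j] by (simp add: turn_start_0)

lemma spiral_turn_Suc: "spiral_turn \<phi> (Suc j) = spiral_point \<phi> ` {turn_start j..turn_start (Suc j)}"
  by (simp add: spiral_turn_def turn_start_def algebra_simps)

lemma turn_start_floor:
  assumes "2 * pi \<le> t"
  obtains j where "turn_start j \<le> t" "t < turn_start (Suc j)"
proof -
  define j where "j = nat \<lfloor>t / (2 * pi)\<rfloor> - 1"
  have "1 \<le> t / (2 * pi)" using assms by simp
  hence ge: "1 \<le> \<lfloor>t / (2 * pi)\<rfloor>" by linarith
  hence "real (Suc j) = of_int \<lfloor>t / (2 * pi)\<rfloor>" unfolding j_def by linarith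
  hence "real (Suc j) \<le> t / (2 * pi)" "t / (2 * pi) < real (Suc (Suc j))" by linarith+
  hence "turn_start j \<le> t" "t < turn_start (Suc j)"
    by (auto simp: turn_start_def field_simps)
  thus ?thesis using that by blast
qed

text \<open>The points with parameters \<open>t\<close> and \<open>t + 2 * pi\<close> lie on the same ray, so injectivity makes
  \<open>\<phi> (t + 2 * pi) - \<phi> t\<close> nowhere zero, hence of constant sign. Were it positive, \<open>\<phi>\<close> would be
  nondecreasing along \<open>t0 + 2 * pi * n\<close> and could not tend to 0. Thus each turn lies inside the
  previous one, ray by ray, although \<open>\<phi>\<close> itself need not be monotone.\<close>

lemma spiral_radius_shift_less:
  assumes cont: "continuous_on {2 * pi..} \<phi>" and pos: "\<And>t. t \<ge> 2 * pi \<Longrightarrow> \<phi> t > 0"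
    and lim: "(\<phi> \<longlongrightarrow> 0) at_top" and arc: "spiral_arc \<phi>" and t0: "t0 \<ge> 2 * pi"
  shows "\<phi> (t0 + 2 * pi) < \<phi> t0"
proof (rule ccontr)
  assume not: "\<not> ?thesis"
  have nonneg: "0 \<le> t" if "2 * pi \<le> t" for t
    using that pi_gt_zero by linarith
  have ne: "\<phi> (t + 2 * pi) \<noteq> \<phi> t" if "t \<ge> 2 * pi" for t
  proof
    assume "\<phi> (t + 2 * pi) = \<phi> t"
    hence eq: "spiral_point \<phi> (t + 2 * pi) = spiral_point \<phi> t"
      by (simp add: spiral_point_eq_cis flip: cis_mult)
    have "t + 2 * pi = t"
      by (rule inj_onD[OF arc[unfolded spiral_arc_def] eq]) (use that nonneg in auto)
    thus False by simp
  qed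
  define g where "g = (\<lambda>t. \<phi> (t + 2 * pi) - \<phi> t)"
  have gcont: "continuous_on {2 * pi..} g"
    unfolding g_def by (intro continuous_intros cont continuous_on_compose2[OF cont]) (auto intro: nonneg)
  have gpos: "g t > 0" if "t \<ge> t0" for t
  proof (rule ccontr)
    assume "\<not> g t > 0"
    moreover have "g t0 \<ge> 0" using not by (simp add: g_def)
    ultimately have "\<exists>x\<ge>t0. x \<le> t \<and> g x = 0"
      using that t0 by (intro IVT2') (auto intro: continuous_on_subset[OF gcont])
    thus False using ne t0 by (auto simp: g_def)
  qed
  have grow: "\<phi> t0 \<le> \<phi> (t0 + 2 * pi * real n)" for n
  proof (induction n)
    case (Suc n)
    have "0 < g (t0 + 2 * pi * real n)" by (rule gpos) simp
    thus ?case using Suc by (simp add: g_def algebra_simps)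
  qed simp
  have "\<forall>\<^sub>F x in at_top. \<phi> x < \<phi> t0"
    using lim pos[OF t0] by (rule order_tendstoD)
  then obtain N where N: "\<And>x. x \<ge> N \<Longrightarrow> \<phi> x < \<phi> t0" by (auto simp: eventually_at_top_linorder)
  obtain n where n: "(N - t0) / (2 * pi) \<le> real n" using real_arch_simple by blast
  have "N \<le> t0 + 2 * pi * real n" using n by (simp add: field_simps)
  thus False using N grow[of n] by force
qed

lemma spiral_radius_shift_le:
  assumes cont: "continuous_on {2 * pi..} \<phi>" and pos: "\<And>t. t \<ge> 2 * pi \<Longrightarrow> \<phi> t > 0"
    and lim: "(\<phi> \<longlongrightarrow> 0) at_top" and arc: "spiral_arc \<phi>" and t: "t \<ge> 2 * pi"
  shows "\<phi> (t + 2 * pi * real n) \<le> \<phi> t"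
proof (induction n)
  case (Suc n)
  have "\<phi> (t + 2 * pi * real n + 2 * pi) < \<phi> (t + 2 * pi * real n)"
    using t by (intro spiral_radius_shift_less cont pos lim arc) (auto intro: add_increasing2)
  thus ?case using Suc by (simp add: algebra_simps)
qed simp

text \<open>Every turn contains a point on the opposite ray, and the chord between the two passes through the
  origin.\<close>

lemma spiral_radius_le_diameter_of_turn:
  assumes pos: "\<And>t. t \<ge> 2 * pi \<Longrightarrow> \<phi> t > 0"
    and t: "t \<in> {turn_start j..turn_start (Suc j)}"
  obtains t' where "t' \<in> {turn_start j..turn_start (Suc j)}"
    "\<phi> t \<le> dist (spiral_point \<phi> t) (spiral_point \<phi> t')"
proof -
  define t' where "t' = (if t + pi \<le> turn_start (Suc j) then t + pi else t - pi)"
  have t': "t' \<in> {turn_start j..turn_start (Suc j)}"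
    using t by (auto simp: t'_def turn_start_Suc)
  have "cis t' = - cis t"
    by (auto simp: t'_def cis_divide[symmetric] simp flip: cis_mult)
  hence "dist (spiral_point \<phi> t) (spiral_point \<phi> t') = norm (of_real (\<phi> t + \<phi> t') * cis t)"
    by (simp add: spiral_point_eq_cis dist_norm algebra_simps)
  also have "\<dots> = \<phi> t + \<phi> t'"
    using pos[of t] pos[of t'] t t' turn_start_ge[of j]
    by (simp add: norm_mult del: of_real_add)
  finally have "\<phi> t \<le> dist (spiral_point \<phi> t) (spiral_point \<phi> t')"
    using pos[of t'] t' turn_start_ge[of j] by simp
  thus ?thesis using that t' by blast
qed

text \<open>The candidate is the sum over all turns of the control of the turn, evaluated at the parameter
  clamped to that turn; its increment \<open>M\<close> from \<open>u\<close> to \<open>v\<close> dominates the increment in each single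
  turn, so chords between points of \<open>[u, v]\<close> in one turn are at most \<open>m = M powr (1/s)\<close>. A long chord
  is handled by geometry, not by adding up the turns in between, which would fail for \<open>s > 1\<close>. If
  \<open>[u, v]\<close> contains the whole turn after that of \<open>u\<close>, all radii of this turn are at most \<open>m\<close>
  because they are bounded by its diameter, and so is the radius of \<open>v\<close>, which lies further inside.
  The chord is then at most \<open>m\<close> up to the end of the turn of \<open>u\<close>, plus \<open>m\<close> down to the origin, plus
  \<open>m\<close> out to \<open>v\<close>. This is the factor 3. Letting \<open>v\<close> tend to infinity gives the bound for the centre
  of the spiral, with \<open>L\<close> as the value of the control there.\<close>

lemma spiral_control_if_turn_controls:
  assumes cont: "continuous_on {2 * pi..} \<phi>" and pos: "\<And>t. t \<ge> 2 * pi \<Longrightarrow> \<phi> t > 0"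
    and lim: "(\<phi> \<longlongrightarrow> 0) at_top" and arc: "spiral_arc \<phi>" and s: "s > 0"
    and T: "\<And>j. control s {turn_start j..turn_start (Suc j)} (spiral_point \<phi>) (T j)"
    and T0: "\<And>j. T j (turn_start j) = 0" and T1: "\<And>j. T j (turn_start (Suc j)) \<le> K j"
    and K: "summable K"
  obtains G L where "control s {2 * pi..} (spiral_point \<phi>) G"
    "\<And>t. t \<ge> 2 * pi \<Longrightarrow> \<phi> t powr s \<le> L - G t"
proof -
  define c where "c = (\<lambda>j t. max (turn_start j) (min t (turn_start (Suc j))))"
  have c_mem: "c j t \<in> {turn_start j..turn_start (Suc j)}" for j t
    using turn_start_less_Suc[of j] by (auto simp: c_def)
  have c_mono: "c j u \<le> c j v" if "u \<le> v" for j u v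
    using that by (auto simp: c_def)
  have Tmono: "T j p \<le> T j q" if "p \<in> {turn_start j..turn_start (Suc j)}"
    "q \<in> {turn_start j..turn_start (Suc j)}" "p \<le> q" for j p q
    using control_mono[OF T that] .
  have T_nonneg: "0 \<le> T j (c j t)" for j t
    using Tmono[of "turn_start j" j "c j t"] c_mem[of j t] turn_start_less_Suc[of j] T0[of j] by auto
  have T_le: "T j (c j t) \<le> K j" for j t
    using Tmono[of "c j t" j "turn_start (Suc j)"] c_mem[of j t] turn_start_less_Suc[of j] T1[of j] by auto
  have sums: "summable (\<lambda>j. T j (c j t))" for t
    using T_nonneg T_le by (intro summable_comparison_test[OF _ K]) auto
  define \<Sigma> where "\<Sigma> = (\<lambda>t. \<Sum>j. T j (c j t))"
  have \<Sigma>_le: "\<Sigma> t \<le> suminf K" for t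
    unfolding \<Sigma>_def by (intro suminf_le T_le sums K)
  have inc: "T j (c j v) - T j (c j u) \<le> \<Sigma> v - \<Sigma> u" if "u \<le> v" for j u v
  proof -
    have "(\<Sum>j\<in>{j}. T j (c j v) - T j (c j u)) \<le> (\<Sum>j. T j (c j v) - T j (c j u))"
      using Tmono[OF c_mem c_mem c_mono[OF that]]
      by (intro sum_le_suminf summable_diff sums) auto
    also have "\<dots> = \<Sigma> v - \<Sigma> u" unfolding \<Sigma>_def by (intro suminf_diff[symmetric] sums)
    finally show ?thesis by simp
  qed
  have ctrl: "dist (spiral_point \<phi> u) (spiral_point \<phi> v) powr s \<le> 3 powr s * (\<Sigma> v - \<Sigma> u)"
    if uv: "2 * pi \<le> u" "u \<le> v" for u v
  proof -
    let ?d = "\<lambda>p q. dist (spiral_point \<phi> p) (spiral_point \<phi> q)"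
    define m where "m = (\<Sigma> v - \<Sigma> u) powr (1 / s)"
    have M: "0 \<le> \<Sigma> v - \<Sigma> u"
      using inc[OF uv(2), of 0] Tmono[OF c_mem c_mem c_mono[OF uv(2)], of 0] by linarith
    have m: "0 \<le> m" by (simp add: m_def)
    have le_m: "?d p q \<le> m" if "c j u \<le> p" "p \<le> q" "q \<le> c j v" for j p q
    proof -
      have pq: "p \<in> {turn_start j..turn_start (Suc j)}" "q \<in> {turn_start j..turn_start (Suc j)}"
        using that c_mem[of j u] c_mem[of j v] by auto
      have "?d p q powr s \<le> T j q - T j p" using controlD[OF T pq] that by simp
      also have "\<dots> \<le> T j (c j v) - T j (c j u)"
        using Tmono[OF c_mem pq(1) that(1)] Tmono[OF pq(2) c_mem that(3)] by linarith
      also have "\<dots> \<le> \<Sigma> v - \<Sigma> u" using inc[OF uv(2)] .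
      finally have "(?d p q powr s) powr (1 / s) \<le> m" using s by (auto simp: m_def intro: powr_mono2)
      thus ?thesis using s by (simp add: powr_powr)
    qed
    obtain j where j: "turn_start j \<le> u" "u < turn_start (Suc j)" using turn_start_floor uv by blast
    have less: "turn_start (Suc j) < turn_start (Suc (Suc j))" by (rule turn_start_less_Suc)
    \<comment> \<open>The last point of \<open>[u, v]\<close> that still belongs to the turn of \<open>u\<close>.\<close>
    define w where "w = min v (turn_start (Suc j))"
    have uw: "?d u w \<le> m"
      using j uv by (intro le_m[of j]) (auto simp: w_def c_def)
    have "?d u v \<le> 3 * m"
    proof (cases "v \<le> turn_start (Suc (Suc j))")
      case True
      have "?d w v \<le> m"
      proof (cases "v \<le> turn_start (Suc j)")
        case True
        thus ?thesis using m by (simp add: w_def)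
      next
        case False
        thus ?thesis using True j less
          by (intro le_m[of "Suc j"]) (auto simp: w_def c_def)
      qed
      thus ?thesis using uw m dist_triangle[of "spiral_point \<phi> u" "spiral_point \<phi> v" "spiral_point \<phi> w"]
        by linarith
    next
      case False
      have radius: "\<phi> t \<le> m" if t: "t \<in> {turn_start (Suc j)..turn_start (Suc (Suc j))}" for t
      proof -
        obtain t' where t': "t' \<in> {turn_start (Suc j)..turn_start (Suc (Suc j))}" "\<phi> t \<le> ?d t t'"
          using spiral_radius_le_diameter_of_turn[OF pos t] .
        have "?d (min t t') (max t t') \<le> m"
          using t t' j False less by (intro le_m[of "Suc j"]) (auto simp: c_def)
        hence "?d t t' \<le> m" by (auto simp: min_def max_def dist_commute split: if_splits)
        thus ?thesis using t' by simp
      qed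
      have w: "w = turn_start (Suc j)" using False less by (simp add: w_def)
      have "\<phi> w \<le> m" using radius less by (simp add: w)
      moreover have "\<phi> v \<le> m"
      proof -
        have "2 * pi \<le> v" using uv by simp
        then obtain k where k: "turn_start k \<le> v" "v < turn_start (Suc k)"
          using turn_start_floor by blast
        have "Suc j \<le> k"
        proof (rule ccontr)
          assume "\<not> Suc j \<le> k"
          hence "turn_start (Suc k) \<le> turn_start (Suc j)" by (intro turn_start_mono) simp
          thus False using k False less by simp
        qed
        then obtain n where n: "k = Suc j + n" using le_Suc_ex by blast
        \<comment> \<open>The point on the ray of \<open>v\<close> in the turn following that of \<open>u\<close>.\<close>
        define v' where "v' = v - 2 * pi * real n"
        have v': "v' \<in> {turn_start (Suc j)..turn_start (Suc (Suc j))}"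
          using k turn_start_add[of "Suc j" n] turn_start_add[of "Suc (Suc j)" n]
          by (simp add: v'_def n)
        have "\<phi> (v' + 2 * pi * real n) \<le> \<phi> v'"
          using v' turn_start_ge[of "Suc j"] by (intro spiral_radius_shift_le cont pos lim arc) auto
        also have "\<dots> \<le> m" using radius v' .
        finally show ?thesis by (simp add: v'_def)
      qed
      moreover have "?d w v \<le> \<phi> w + \<phi> v"
        using norm_triangle_ineq4[of "spiral_point \<phi> w" "spiral_point \<phi> v"]
          pos[of w] pos[of v] uv turn_start_ge[of "Suc j"]
        by (simp add: dist_norm norm_spiral_point w)
      ultimately show ?thesis
        using uw dist_triangle[of "spiral_point \<phi> u" "spiral_point \<phi> v" "spiral_point \<phi> w"]
        by linarith
    qed
    hence "?d u v powr s \<le> (3 * m) powr s" using s by (intro powr_mono2) auto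
    also have "\<dots> = 3 powr s * (\<Sigma> v - \<Sigma> u)"
      using s M m by (simp add: powr_mult m_def powr_powr)
    finally show ?thesis .
  qed
  show ?thesis
  proof (rule that[of "\<lambda>t. 3 powr s * \<Sigma> t" "3 powr s * suminf K"])
    show "control s {2 * pi..} (spiral_point \<phi>) (\<lambda>t. 3 powr s * \<Sigma> t)"
      using ctrl by (auto simp: control_def algebra_simps)
    fix t :: real assume t: "t \<ge> 2 * pi"
    have "\<forall>\<^sub>F v in at_top. norm (spiral_point \<phi> v) = \<phi> v"
      using eventually_ge_at_top[of "2 * pi"]
      by eventually_elim (simp add: norm_spiral_point pos less_imp_le)
    hence "((\<lambda>v. norm (spiral_point \<phi> v)) \<longlongrightarrow> 0) at_top"
      using lim by (simp add: tendsto_cong)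
    hence "(spiral_point \<phi> \<longlongrightarrow> 0) at_top" by (simp add: tendsto_norm_zero_iff)
    hence "((\<lambda>v. dist (spiral_point \<phi> t) (spiral_point \<phi> v) powr s) \<longlongrightarrow>
        dist (spiral_point \<phi> t) 0 powr s) at_top"
      using s by (intro tendsto_powr' tendsto_dist tendsto_const) auto
    moreover have "\<forall>\<^sub>F v in at_top. dist (spiral_point \<phi> t) (spiral_point \<phi> v) powr s
        \<le> 3 powr s * (suminf K - \<Sigma> t)"
      using eventually_ge_at_top[of t]
    proof eventually_elim
      case (elim v)
      have "3 powr s * (\<Sigma> v - \<Sigma> t) \<le> 3 powr s * (suminf K - \<Sigma> t)"
        using \<Sigma>_le[of v] by (intro mult_left_mono) auto
      thus ?case using ctrl[OF t elim] by linarith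
    qed
    ultimately have "dist (spiral_point \<phi> t) 0 powr s \<le> 3 powr s * (suminf K - \<Sigma> t)"
      by (intro tendsto_upperbound) auto
    thus "\<phi> t powr s \<le> 3 powr s * suminf K - 3 powr s * \<Sigma> t"
      using pos[OF t] by (simp add: norm_spiral_point algebra_simps)
  qed
qed

text \<open>The substitution \<open>t = 2 * pi / (1 - r)\<close> turns the spiral with its centre into an arc over \<open>[0, 1]\<close>, and
  the control extends to \<open>r = 1\<close> by the value \<open>L\<close>, whether or not this is continuous there.\<close>

lemma holder_arc_if_spiral_control:
  assumes cont: "continuous_on {2 * pi..} \<phi>" and pos: "\<And>t. t \<ge> 2 * pi \<Longrightarrow> \<phi> t > 0"
    and lim: "(\<phi> \<longlongrightarrow> 0) at_top" and arc: "spiral_arc \<phi>" and s: "s > 0"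
    and G: "control s {2 * pi..} (spiral_point \<phi>) G"
    and L: "\<And>t. t \<ge> 2 * pi \<Longrightarrow> \<phi> t powr s \<le> L - G t"
  shows "holder_arc (1 / s) (spiral \<phi>)"
proof -
  define \<theta> where "\<theta> = (\<lambda>r::real. 2 * pi / (1 - r))"
  define P where "P = (\<lambda>r. if r < 1 then spiral_point \<phi> (\<theta> r) else 0)"
  have \<theta>_ge: "2 * pi \<le> \<theta> r" if "0 \<le> r" "r < 1" for r
    using that mult_right_mono[of "1 - r" 1 "2 * pi"] by (simp add: \<theta>_def field_simps)
  have \<theta>_mono: "\<theta> p \<le> \<theta> q" if "p \<le> q" "q < 1" for p q
    using that by (simp add: \<theta>_def frac_le)
  have inj: "inj_on (spiral_point \<phi>) {2 * pi..}" using arc by (simp add: spiral_arc_def)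
  have nz: "spiral_point \<phi> t \<noteq> 0" if "t \<ge> 2 * pi" for t
    using pos[OF that] by (simp add: spiral_point_eq_cis)
  have image: "P ` {0..1} = spiral \<phi>"
  proof
    show "P ` {0..1} \<subseteq> spiral \<phi>" using \<theta>_ge by (auto simp: P_def spiral_def)
    have "spiral_point \<phi> t \<in> P ` {0..1}" if "t \<ge> 2 * pi" for t
    proof (rule image_eqI)
      have "t > 0" using that pi_gt_zero by linarith
      thus "1 - 2 * pi / t \<in> {0..1}" "spiral_point \<phi> t = P (1 - 2 * pi / t)"
        using that by (auto simp: P_def \<theta>_def)
    qed
    moreover have "0 \<in> P ` {0..1}" by (rule image_eqI[of _ _ 1]) (auto simp: P_def)
    ultimately show "spiral \<phi> \<subseteq> P ` {0..1}" by (auto simp: spiral_def)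
  qed
  have Pinj: "inj_on P {0..1}"
  proof (rule inj_onI)
    fix p q :: real assume pq: "p \<in> {0..1}" "q \<in> {0..1}" "P p = P q"
    show "p = q"
    proof (cases "p < 1 \<and> q < 1")
      case True
      hence "\<theta> p = \<theta> q" using pq \<theta>_ge inj_onD[OF inj, of "\<theta> p" "\<theta> q"] by (auto simp: P_def)
      thus ?thesis using True by (simp add: \<theta>_def field_simps)
    next
      case False
      thus ?thesis using pq nz[OF \<theta>_ge] by (auto simp: P_def split: if_splits)
    qed
  qed
  have Pcont: "continuous_on {0..1} P"
    unfolding continuous_on_eq_continuous_within
  proof
    fix r :: real assume r: "r \<in> {0..1}"
    show "continuous (at r within {0..1}) P"
    proof (cases "r < 1")
      case True
      have spcont: "continuous_on {2 * pi..} (spiral_point \<phi>)"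
        unfolding spiral_point_def by (intro continuous_intros cont)
      have "continuous_on {0..<1} (\<lambda>r. spiral_point \<phi> (\<theta> r))"
        using \<theta>_ge unfolding \<theta>_def
        by (intro continuous_on_compose2[OF spcont] continuous_intros) auto
      hence "continuous_on {0..<1} P"
        by (rule continuous_on_eq) (auto simp: P_def)
      hence "continuous (at r within {0..<1}) P"
        using r True by (simp add: continuous_on_eq_continuous_within)
      moreover have "at r within {0..<1} = at r within {0..1}"
        by (rule at_within_nhd[of _ "{..<1}"]) (use True in auto)
      ultimately show ?thesis by simp
    next
      case False
      hence r1: "r = 1" using r by simp
      have "((\<lambda>r::real. 1 - r) \<longlongrightarrow> 1 - 1) (at_left 1)" by (intro tendsto_intros)
      moreover have less1: "\<forall>\<^sub>F r in at_left 1. r < (1::real)" by (simp add: eventually_at_filter)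
      ultimately have "filterlim (\<lambda>r::real. inverse (1 - r)) at_top (at_left 1)"
        by (intro filterlim_inverse_at_top) (auto elim: eventually_mono)
      hence "filterlim (\<lambda>r. 2 * pi * inverse (1 - r)) at_top (at_left 1)"
        by (intro filterlim_tendsto_pos_mult_at_top[OF tendsto_const]) auto
      hence \<theta>lim: "filterlim \<theta> at_top (at_left 1)" by (simp add: \<theta>_def divide_inverse)
      have "((\<lambda>r. norm (P r)) \<longlongrightarrow> 0) (at_left 1)"
      proof (rule Lim_transform_eventually[OF filterlim_compose[OF lim \<theta>lim]])
        have "\<forall>\<^sub>F r in at_left 1. 2 * pi \<le> \<theta> r" using \<theta>lim by (auto simp: filterlim_at_top)
        thus "\<forall>\<^sub>F r in at_left 1. \<phi> (\<theta> r) = norm (P r)"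
          using less1 by eventually_elim (simp add: P_def norm_spiral_point pos less_imp_le)
      qed
      hence "(P \<longlongrightarrow> 0) (at_left 1)" by (simp add: tendsto_norm_zero_iff)
      thus ?thesis by (simp add: r1 continuous_within P_def at_within_Icc_at_left)
    qed
  qed
  have "control s {0..1} P (\<lambda>r. if r < 1 then G (\<theta> r) else L)"
    unfolding control_def
  proof (intro ballI impI)
    fix p q :: real assume pq: "p \<in> {0..1}" "q \<in> {0..1}" "p \<le> q"
    consider "q < 1" | "p < 1" "q = 1" | "p = 1" "q = 1" using pq by force
    thus "dist (P p) (P q) powr s \<le> (if q < 1 then G (\<theta> q) else L) - (if p < 1 then G (\<theta> p) else L)"
    proof cases
      case 1
      thus ?thesis using pq controlD[OF G, of "\<theta> p" "\<theta> q"] \<theta>_ge \<theta>_mono by (simp add: P_def)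
    next
      case 2
      thus ?thesis using pq L[OF \<theta>_ge, of p] pos[OF \<theta>_ge, of p] by (simp add: P_def norm_spiral_point)
    next
      case 3
      thus ?thesis by (simp add: P_def)
    qed
  qed
  hence "holder_arc (1 / s) (P ` {0..1})"
    by (intro holder_arc_if_control Pcont Pinj s) auto
  thus ?thesis by (simp add: image)
qed

section \<open>From a convergent series to a Hoelder arc\<close>

lemma holder_const_less_obtains:
  assumes fin: "holder_const \<alpha> X < \<infinity>" and e: "e > 0"
  obtains H f where "0 < H" "H \<le> enn2real (holder_const \<alpha> X) + e" "f ` {0..1::real} = X"
    "\<And>x y. x \<in> {0..1} \<Longrightarrow> y \<in> {0..1} \<Longrightarrow> dist (f x) (f y) \<le> H * \<bar>x - y\<bar> powr \<alpha>"
proof -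
  define h where "h = enn2real (holder_const \<alpha> X)"
  have h: "holder_const \<alpha> X = ennreal h" "0 \<le> h" using fin by (auto simp: h_def less_top)
  have "holder_const \<alpha> X < ennreal (h + e)"
    unfolding h(1) using h(2) e by (intro ennreal_lessI) auto
  then obtain H f where H: "H > 0" "ennreal H < ennreal (h + e)" and f: "f ` {0..1::real} = X"
    "\<forall>x\<in>{0..1}. \<forall>y\<in>{0..1}. dist (f x) (f y) \<le> H * \<bar>x - y\<bar> powr \<alpha>"
    unfolding holder_const_def Inf_less_iff by blast
  have "H \<le> h + e" using H by (simp add: ennreal_less_iff)
  thus ?thesis using that[of H f] H f by (simp add: h_def)
qed

text \<open>For each turn, a surjection with nearly optimal constant yields a control. Its constant may exceed
  the infimum by \<open>2 ^ -j\<close>; since \<open>(h + q) powr s \<le> 2 powr s * (h powr s + q powr s)\<close>, this costs only a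
  convergent geometric series and a factor independent of \<open>j\<close>.\<close>

lemma holder_arc_if_summable:
  assumes cont: "continuous_on {2 * pi..} \<phi>" and pos: "\<And>t. t \<ge> 2 * pi \<Longrightarrow> \<phi> t > 0"
    and lim: "(\<phi> \<longlongrightarrow> 0) at_top" and arc: "spiral_arc \<phi>" and s: "s \<ge> 1"
    and fin: "(\<Sum>j. ennreal_powr (holder_const (1 / s) (spiral_turn \<phi> (Suc j))) s) < \<infinity>"
  shows "holder_arc (1 / s) (spiral \<phi>)"
proof -
  let ?H = "\<lambda>j. holder_const (1 / s) (spiral_turn \<phi> (Suc j))"
  define h where "h = (\<lambda>j. enn2real (?H j))"
  have finite: "?H j < \<infinity>" for j
  proof -
    have "ennreal_powr (?H j) s < \<infinity>"
      using ennreal_suminf_lessD[OF fin] .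
    thus ?thesis by (auto simp: ennreal_powr_def less_top split: if_splits)
  qed
  have "ennreal_powr (?H j) s = ennreal (h j powr s)" for j
    using finite[of j] by (auto simp: ennreal_powr_def h_def)
  hence "(\<Sum>j. ennreal (h j powr s)) \<noteq> top" using fin by simp
  hence summ: "summable (\<lambda>j. h j powr s)" by (intro summable_suminf_not_top) auto
  have inj: "inj_on (spiral_point \<phi>) {turn_start j..turn_start (Suc j)}" for j
    using arc turn_start_ge[of j] by (auto simp: spiral_arc_def intro: inj_on_subset)
  have spcont: "continuous_on {turn_start j..turn_start (Suc j)} (spiral_point \<phi>)" for j
    unfolding spiral_point_def using turn_start_ge[of j]
    by (intro continuous_intros continuous_on_subset[OF cont]) auto
  define K where "K = (\<lambda>j. 2 powr s * (h j powr s + (1 / 2) ^ j))"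
  have "\<exists>T. control s {turn_start j..turn_start (Suc j)} (spiral_point \<phi>) T \<and>
      T (turn_start j) = 0 \<and> T (turn_start (Suc j)) \<le> K j" for j
  proof -
    define q :: real where "q = (1 / 2) ^ j"
    have q: "0 < q" "q \<le> 1" by (auto simp: q_def power_le_one)
    obtain H f where H: "0 < H" "H \<le> h j + q" and f: "f ` {0..1::real} = spiral_turn \<phi> (Suc j)"
      "\<And>x y. x \<in> {0..1} \<Longrightarrow> y \<in> {0..1} \<Longrightarrow> dist (f x) (f y) \<le> H * \<bar>x - y\<bar> powr (1 / s)"
      using holder_const_less_obtains[OF finite[of j] q(1)] unfolding h_def by metis
    obtain T where T: "control s {turn_start j..turn_start (Suc j)} (spiral_point \<phi>) T"
      "T (turn_start j) = 0" "T (turn_start (Suc j)) \<le> H powr s"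
    proof (rule control_if_holder_surjection[OF spcont inj _ _ H(1)])
      show "f ` {0..1} = spiral_point \<phi> ` {turn_start j..turn_start (Suc j)}"
        using f(1) by (simp add: spiral_turn_Suc)
    qed (use turn_start_less_Suc[of j] s f(2) in auto)
    have "H powr s \<le> (2 * max (h j) q) powr s"
      using H s by (intro powr_mono2) auto
    also have "\<dots> = 2 powr s * max (h j) q powr s"
      using q by (subst powr_mult) auto
    also have "\<dots> \<le> 2 powr s * (h j powr s + q powr s)"
      by (intro mult_left_mono) (auto simp: max_def)
    also have "\<dots> \<le> 2 powr s * (h j powr s + q)"
      using powr_mono'[of 1 s q] q s by (intro mult_left_mono add_left_mono) auto
    finally show ?thesis using T by (auto simp: K_def q_def)
  qed
  then obtain T where T: "\<And>j. control s {turn_start j..turn_start (Suc j)} (spiral_point \<phi>) (T j)"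
      "\<And>j. T j (turn_start j) = 0" "\<And>j. T j (turn_start (Suc j)) \<le> K j"
    by metis
  have "summable K"
    unfolding K_def by (intro summable_mult summable_add summ summable_geometric) auto
  then obtain G L where "control s {2 * pi..} (spiral_point \<phi>) G"
    "\<And>t. t \<ge> 2 * pi \<Longrightarrow> \<phi> t powr s \<le> L - G t"
    using spiral_control_if_turn_controls[OF cont pos lim arc _ T] s by auto
  thus ?thesis using s by (intro holder_arc_if_spiral_control[OF cont pos lim arc]) auto
qed

section \<open>From a Hoelder arc to a convergent series\<close>

text \<open>Stretching \<open>[a, b]\<close> affinely to \<open>[0, 1]\<close> multiplies a \<open>1/s\<close>-Hoelder constant by the \<open>1/s\<close>-th power of
  the length \<open>b - a\<close>, so its \<open>s\<close>-th power scales like the length itself.\<close>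

lemma holder_const_subarc_le:
  fixes f :: "real \<Rightarrow> 'a::metric_space"
  assumes C: "C > 0" and ab: "0 \<le> a" "a < b" "b \<le> 1" and s: "s > 0"
    and holder: "\<And>x y. x \<in> {0..1} \<Longrightarrow> y \<in> {0..1} \<Longrightarrow> dist (f x) (f y) \<le> C * dist x y powr (1 / s)"
  shows "ennreal_powr (holder_const (1 / s) (f ` {a..b})) s \<le> ennreal (C powr s * (b - a))"
proof -
  define H where "H = C * (b - a) powr (1 / s)"
  have H: "H > 0" using C ab by (simp add: H_def)
  have "(\<lambda>x. f (a + (b - a) * x)) ` {0..1} = f ` (\<lambda>x. (b - a) * x + a) ` {0..1}"
    by (simp only: image_image add.commute)
  also have "(\<lambda>x. (b - a) * x + a) ` {0..1} = {a..b}"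
    using ab by (subst image_affinity_atLeastAtMost) auto
  finally have im: "(\<lambda>x. f (a + (b - a) * x)) ` {0..1} = f ` {a..b}" .
  have "dist (f (a + (b - a) * x)) (f (a + (b - a) * y)) \<le> H * \<bar>x - y\<bar> powr (1 / s)"
    if xy: "x \<in> {0..1}" "y \<in> {0..1}" for x y
  proof -
    have mem: "a + (b - a) * x \<in> {0..1}" if "x \<in> {0..1}" for x
    proof -
      have "0 \<le> (b - a) * x" "(b - a) * x \<le> b - a"
        using that ab mult_left_le[of x "b - a"] by auto
      hence "0 \<le> a + (b - a) * x" "a + (b - a) * x \<le> 1" using ab by linarith+
      thus ?thesis by simp
    qed
    have "dist (a + (b - a) * x) (a + (b - a) * y) = (b - a) * \<bar>x - y\<bar>"
      using ab by (simp add: dist_real_def abs_mult flip: right_diff_distrib)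
    thus ?thesis
      using holder[OF mem[OF xy(1)] mem[OF xy(2)]] ab by (simp add: H_def powr_mult mult.assoc)
  qed
  hence "holder_const (1 / s) (f ` {a..b}) \<le> ennreal H"
    unfolding holder_const_def using H im
    by (intro Inf_lower) blast
  hence le: "holder_const (1 / s) (f ` {a..b}) < \<infinity>" "enn2real (holder_const (1 / s) (f ` {a..b})) \<le> H"
    using H by (auto simp: enn2real_leI intro: le_less_trans)
  hence "enn2real (holder_const (1 / s) (f ` {a..b})) powr s \<le> H powr s"
    using s by (intro powr_mono2) auto
  also have "H powr s = C powr s * (b - a)"
    using C ab s by (simp add: H_def powr_mult powr_powr)
  finally show ?thesis using le(1) by (auto simp: ennreal_powr_def intro!: ennreal_leI)
qed

lemma suminf_length_disjoint_intervals_le: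
  fixes a b :: "nat \<Rightarrow> real"
  assumes ab: "\<And>j. 0 \<le> a j" "\<And>j. a j \<le> b j" "\<And>j. b j \<le> 1"
    and disj: "disjoint_family (\<lambda>j. {a j<..<b j})"
  shows "(\<Sum>j. ennreal (b j - a j)) \<le> 1"
proof -
  have "(\<Sum>j. ennreal (b j - a j)) = (\<Sum>j. emeasure lborel {a j<..<b j})"
    using ab(2) by simp
  also have "\<dots> = emeasure lborel (\<Union>j. {a j<..<b j})"
    by (rule suminf_emeasure[OF _ disj]) auto
  also have "\<dots> \<le> emeasure lborel {0..1::real}"
  proof (rule emeasure_mono)
    show "(\<Union>j. {a j<..<b j}) \<subseteq> {0..1}"
    proof
      fix x assume "x \<in> (\<Union>j. {a j<..<b j})"
      then obtain j where "a j < x" "x < b j" by auto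
      thus "x \<in> {0..1}" using ab(1)[of j] ab(3)[of j] by simp
    qed
  qed simp
  finally show ?thesis by simp
qed

lemma spiral_turns_Int:
  assumes arc: "spiral_arc \<phi>" and ij: "i < j"
  shows "spiral_turn \<phi> (Suc i) \<inter> spiral_turn \<phi> (Suc j) \<subseteq> {spiral_point \<phi> (turn_start j)}"
proof
  fix z assume "z \<in> spiral_turn \<phi> (Suc i) \<inter> spiral_turn \<phi> (Suc j)"
  then obtain t t' where t: "t \<in> {turn_start i..turn_start (Suc i)}" "z = spiral_point \<phi> t"
    and t': "t' \<in> {turn_start j..turn_start (Suc j)}" "z = spiral_point \<phi> t'"
    by (auto simp: spiral_turn_Suc)
  have "t = t'"
    using arc t t' turn_start_ge[of i] turn_start_ge[of j]
    by (auto simp: spiral_arc_def dest: inj_onD)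
  thus "z \<in> {spiral_point \<phi> (turn_start j)}"
    using t t' turn_start_mono[of "Suc i" j] ij by (auto intro!: arg_cong[of _ _ "spiral_point \<phi>"])
qed

text \<open>The inverse of the parametrization maps each turn to a compact connected set, that is, to an interval.
  Different turns share at most one point, so the interiors of these intervals are disjoint and their
  lengths add up to at most 1; up to a constant factor, these lengths dominate the terms of the
  series.\<close>

lemma summable_if_holder_arc:
  assumes cont: "continuous_on {2 * pi..} \<phi>" and arc: "spiral_arc \<phi>" and s: "s > 0"
    and holder: "holder_arc (1 / s) (spiral \<phi>)"
  shows "(\<Sum>j. ennreal_powr (holder_const (1 / s) (spiral_turn \<phi> (Suc j))) s) < \<infinity>"
proof -
  obtain f :: "real \<Rightarrow> complex" and g C where fg: "homeomorphism {0..1} (spiral \<phi>) f g"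
    and C: "C > 0" and "\<forall>x\<in>{0..1}. \<forall>y\<in>{0..1}. dist (f x) (f y) \<le> C * dist x y powr (1 / s)"
    using holder unfolding holder_arc_def holder_on_def by blast
  hence f: "dist (f x) (f y) \<le> C * dist x y powr (1 / s)" if "x \<in> {0..1}" "y \<in> {0..1}" for x y
    using that by blast
  have finj: "inj_on f {0..1}" using fg by (metis homeomorphism_def inj_on_inverseI)
  define X where "X = (\<lambda>j. spiral_turn \<phi> (Suc j))"
  have "\<exists>a b. 0 \<le> a \<and> a < b \<and> b \<le> 1 \<and> X j = f ` {a..b}" for j
  proof -
    have sub: "X j \<subseteq> spiral \<phi>"
      using turn_start_ge[of j] by (auto simp: X_def spiral_turn_Suc spiral_def)
    have spcont: "continuous_on {turn_start j..turn_start (Suc j)} (spiral_point \<phi>)"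
      unfolding spiral_point_def using turn_start_ge[of j]
      by (intro continuous_intros continuous_on_subset[OF cont]) auto
    have gcont: "continuous_on (X j) g"
      using homeomorphism_cont2[OF fg] sub by (rule continuous_on_subset)
    have "compact (X j)" "connected (X j)"
      using spcont by (auto simp: X_def spiral_turn_Suc intro: compact_continuous_image connected_continuous_image)
    hence "compact (g ` X j)" "connected (g ` X j)"
      using gcont by (auto intro: compact_continuous_image connected_continuous_image)
    then obtain a b where ab: "g ` X j = {a..b}"
      using connected_compact_interval_1[of "g ` X j"] by auto
    have fX: "f ` {a..b} = X j"
      using homeomorphism_apply2[OF fg] sub by (force simp flip: ab)
    have "{a..b} \<subseteq> {0..1}" using ab sub homeomorphism_image2[OF fg] by blast
    moreover have "a < b"
    proof (rule ccontr)
      assume "\<not> a < b"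
      have "spiral_point \<phi> (turn_start j) \<in> f ` {a..b}" "spiral_point \<phi> (turn_start (Suc j)) \<in> f ` {a..b}"
        using turn_start_less_Suc[of j] unfolding fX by (auto simp: X_def spiral_turn_Suc)
      hence "spiral_point \<phi> (turn_start j) = spiral_point \<phi> (turn_start (Suc j))"
        using \<open>\<not> a < b\<close> by (cases "a = b") auto
      hence "turn_start j = turn_start (Suc j)"
        using arc turn_start_ge by (auto simp: spiral_arc_def dest: inj_onD)
      thus False using turn_start_less_Suc[of j] by simp
    qed
    ultimately show ?thesis using fX by (intro exI[of _ a] exI[of _ b]) auto
  qed
  then obtain a b where ab: "\<And>j. 0 \<le> a j" "\<And>j. a j < b j" "\<And>j. b j \<le> 1" "\<And>j. X j = f ` {a j..b j}"
    by metis
  have disj: "{a i<..<b i} \<inter> {a j<..<b j} = {}" if "i < j" for i j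
  proof (rule ccontr)
    assume "\<not> ?thesis"
    then obtain x where "x \<in> {a i<..<b i}" "x \<in> {a j<..<b j}" by blast
    hence x: "a i < x" "x < b i" "a j < x" "x < b j" by simp_all
    \<comment> \<open>A second common point besides \<open>x\<close>: two turns cannot share both images.\<close>
    define y where "y = (x + min (b i) (b j)) / 2"
    have y: "x < y" "y < b i" "y < b j" using x by (auto simp: y_def min_def)
    have sub: "X i \<inter> X j \<subseteq> {spiral_point \<phi> (turn_start j)}"
      using spiral_turns_Int[OF arc that] by (simp add: X_def)
    have both: "f x \<in> X i \<inter> X j" "f y \<in> X i \<inter> X j" using x y by (auto simp: ab(4))
    have "f x = f y" using subsetD[OF sub both(1)] subsetD[OF sub both(2)] by simp
    moreover have "x \<in> {0..1}" "y \<in> {0..1}" using x y ab(1)[of i] ab(3)[of i] by auto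
    ultimately show False using finj y by (auto dest: inj_onD)
  qed
  have "disjoint_family (\<lambda>j. {a j<..<b j})"
    unfolding disjoint_family_on_def using disj by (metis Int_commute linorder_neqE_nat)
  hence len: "(\<Sum>j. ennreal (b j - a j)) \<le> 1"
    by (rule suminf_length_disjoint_intervals_le[OF ab(1) less_imp_le[OF ab(2)] ab(3)])
  have "(\<Sum>j. ennreal_powr (holder_const (1 / s) (X j)) s) \<le> (\<Sum>j. ennreal (C powr s * (b j - a j)))"
    unfolding ab(4) by (intro suminf_le holder_const_subarc_le[OF C ab(1,2,3) s f]) auto
  also have "\<dots> = ennreal (C powr s) * (\<Sum>j. ennreal (b j - a j))"
    using ab(2) by (simp add: ennreal_mult less_imp_le)
  also have "\<dots> \<le> ennreal (C powr s) * 1" by (intro mult_left_mono len) simp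
  also have "\<dots> < \<infinity>" by simp
  finally show ?thesis by (simp add: X_def)
qed

section \<open>Hoelder spirals characterized by their turns\<close>

theorem theorem3p1:
  fixes \<phi> :: "real \<Rightarrow> real" and s :: real
  assumes "continuous_on {2 * pi..} \<phi>"
    and "\<And>t. t \<ge> 2 * pi \<Longrightarrow> \<phi> t > 0"
    and "(\<phi> \<longlongrightarrow> 0) at_top"
    and "spiral_arc \<phi>"
    and "s \<ge> 1"
  shows "holder_arc (1 / s) (spiral \<phi>) \<longleftrightarrow>
    (\<Sum>j. ennreal_powr (holder_const (1 / s) (spiral_turn \<phi> (Suc j))) s) < \<infinity>"
proof
  assume "holder_arc (1 / s) (spiral \<phi>)"
  thus "(\<Sum>j. ennreal_powr (holder_const (1 / s) (spiral_turn \<phi> (Suc j))) s) < \<infinity>"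
    using assms by (intro summable_if_holder_arc) auto
next
  assume "(\<Sum>j. ennreal_powr (holder_const (1 / s) (spiral_turn \<phi> (Suc j))) s) < \<infinity>"
  thus "holder_arc (1 / s) (spiral \<phi>)"
    using assms by (intro holder_arc_if_summable)
qed

end
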